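(* Let $A_h\le\alpha_h^2B_h$ in $H_h$ and let the condition $\frac16h_t^2\alpha_h^2\le(1-\varepsilon_0^2)\underline\rho$ be valid for some $0<\varepsilon_0<1$. Let $w\in H_h$ be the solution to the equation $$B_h(\rho w)+\tfrac1{12}h_t^2A_hw=b\quad\text{in }H_h,$$ with a given $b\in H_h$. For the one-step iterative method $$B_h\Big(\rho\,\frac{w^{(l+1)}-w^{(l)}}{\theta}\Big)+B_h(\rho w^{(l)})+\tfrac1{12}h_t^2A_hw^{(l)}=b,\quad l\ge0,$$ with the parameter $\theta:=\theta_{opt}=2/(1+\bar\lambda(\varepsilon_0^2))$, where $\bar\lambda(\varepsilon_0^2):=1+\frac12(1-\varepsilon_0^2)$, the convergence rate estimate $$\|w-w^{(l)}\|\le q_0^l\,\|w-w^{(0)}\|,\quad l\ge0,\quad\forall w^{(0)}\in H_h,$$ holds in the two norms $\|\cdot\|=\|\sqrt\rho\,\cdot\|_h$ and $\|\cdot\|=\|\cdot\|_{\mathcal A_{\mathbf h}}$, with $\mathcal A_{\mathbf h}:=D_\rho+\frac1{12}h_t^2B_h^{-1}A_h$ and $$q_0=q_0(\varepsilon_0^2):=\frac{\bar\lambda(\varepsilon_0^2)-1}{\bar\lambda(\varepsilon_0^2)+1}=\frac{1-\varepsilon_0^2}{5-\varepsilon_0^2}\le0.2\quad\text{for }\varepsilon_0^2\in[0,1).$$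
   Context: $H_h$ is a finite-dimensional Euclidean space of real functions on a spatial mesh (e.g. functions on a uniform rectangular mesh vanishing at boundary nodes) with a mesh $L^2$ inner product $(\cdot,\cdot)_h$ and norm $\|\cdot\|_h$. $A_h=A_h^*>0$ and $B_h=B_h^*>0$ are any commuting linear operators in $H_h$. $\rho(x)\ge\underline\rho>0$ is a given function, $\underline\rho$ constant; $D_\rho w:=\rho w$ (pointwise multiplication). $h_t>0$ is the time step. For $C_h=C_h^*>0$ in $H_h$, $\|w\|_{C_h}=(C_hw,w)_h^{1/2}$. *)

theory Defs
  imports "HOL-Analysis.Analysis"
begin

text \<open>
  Mesh nodes are the elements of a finite type \<open>'n\<close>, so mesh functions have type \<open>real ^ 'n\<close>.
  The product \<open>\<rho> * w\<close> on this type is the library's componentwise product, i.e. \<open>D\<^sub>\<rho> w\<close>.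
  The space \<open>H\<^sub>h\<close> is a subspace \<open>H\<close>, e.g. the functions vanishing at given boundary nodes.
  Operators in \<open>H\<^sub>h\<close> are functions whose values outside \<open>H\<close> are irrelevant.
\<close>

definition mesh_inner :: "real ^ 'n \<Rightarrow> real ^ 'n \<Rightarrow> real ^ 'n \<Rightarrow> real" where
  "mesh_inner \<mu> u v = (\<Sum>i\<in>UNIV. \<mu> $ i * u $ i * v $ i)"

definition mesh_norm :: "real ^ 'n \<Rightarrow> real ^ 'n \<Rightarrow> real" where
  "mesh_norm \<mu> u = sqrt (mesh_inner \<mu> u u)"

text \<open>
  Weights may vanish at nodes that the mesh \<open>L\<^sup>2\<close> inner product leaves out (such as boundary
  nodes), as long as the inner product is positive definite on \<open>H\<close>.
\<close>

definition mesh_space :: "real ^ 'n \<Rightarrow> (real ^ 'n) set \<Rightarrow> bool" where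
  "mesh_space \<mu> H \<longleftrightarrow>
     subspace H \<and> (\<forall>i. 0 \<le> \<mu> $ i) \<and> (\<forall>u\<in>H. u \<noteq> 0 \<longrightarrow> 0 < mesh_inner \<mu> u u)"

definition linear_op_in :: "(real ^ 'n) set \<Rightarrow> (real ^ 'n \<Rightarrow> real ^ 'n) \<Rightarrow> bool" where
  "linear_op_in H C \<longleftrightarrow>
     (\<forall>u\<in>H. C u \<in> H) \<and>
     (\<forall>u\<in>H. \<forall>v\<in>H. C (u + v) = C u + C v) \<and>
     (\<forall>c. \<forall>u\<in>H. C (c *\<^sub>R u) = c *\<^sub>R C u)"

definition selfadjoint_pos ::
    "real ^ 'n \<Rightarrow> (real ^ 'n) set \<Rightarrow> (real ^ 'n \<Rightarrow> real ^ 'n) \<Rightarrow> bool" where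
  "selfadjoint_pos \<mu> H C \<longleftrightarrow>
     linear_op_in H C \<and>
     (\<forall>u\<in>H. \<forall>v\<in>H. mesh_inner \<mu> (C u) v = mesh_inner \<mu> u (C v)) \<and>
     (\<forall>u\<in>H. u \<noteq> 0 \<longrightarrow> 0 < mesh_inner \<mu> (C u) u)"

definition op_le ::
    "real ^ 'n \<Rightarrow> (real ^ 'n) set \<Rightarrow> (real ^ 'n \<Rightarrow> real ^ 'n) \<Rightarrow> (real ^ 'n \<Rightarrow> real ^ 'n) \<Rightarrow> bool" where
  "op_le \<mu> H C D \<longleftrightarrow> (\<forall>u\<in>H. mesh_inner \<mu> (C u) u \<le> mesh_inner \<mu> (D u) u)"

definition energy_norm :: "real ^ 'n \<Rightarrow> (real ^ 'n \<Rightarrow> real ^ 'n) \<Rightarrow> real ^ 'n \<Rightarrow> real" where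
  "energy_norm \<mu> C u = sqrt (mesh_inner \<mu> (C u) u)"

text \<open>
  \<open>inv_into H B\<close> is \<open>B\<^sub>h\<^sup>-\<^sup>1\<close> in \<open>H\<close>: a positive definite \<open>B\<close> is a bijection of \<open>H\<close> onto itself.
\<close>

definition calA ::
    "(real ^ 'n) set \<Rightarrow> (real ^ 'n \<Rightarrow> real ^ 'n) \<Rightarrow> (real ^ 'n \<Rightarrow> real ^ 'n) \<Rightarrow>
     real ^ 'n \<Rightarrow> real \<Rightarrow> real ^ 'n \<Rightarrow> real ^ 'n" where
  "calA H A B \<rho> h\<^sub>t u = \<rho> * u + (h\<^sub>t\<^sup>2 / 12) *\<^sub>R inv_into H B (A u)"

text \<open>The argument \<open>s\<close> below stands for \<open>\<epsilon>\<^sub>0\<^sup>2\<close>.\<close>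

definition lambda_bar :: "real \<Rightarrow> real" where
  "lambda_bar s = 1 + (1 - s) / 2"

definition theta_opt :: "real \<Rightarrow> real" where
  "theta_opt s = 2 / (1 + lambda_bar s)"

definition q0 :: "real \<Rightarrow> real" where
  "q0 s = (lambda_bar s - 1) / (lambda_bar s + 1)"

end

theory Submission
  imports Defs
begin

text \<open>
  Put \<open>c = h\<^sub>t\<^sup>2 / 12\<close> and \<open>K = B\<^sup>-\<^sup>1 A\<close>. Since \<open>B\<close> is invertible on \<open>H\<close>, subtracting the scheme from the
  equation for \<open>w\<close> and cancelling \<open>B\<close> shows that the errors \<open>e\<^sub>l = w - w\<^sup>l\<close> satisfy
  \<open>\<rho> (e\<^sub>l\<^sub>+\<^sub>1 - e\<^sub>l) = - \<theta> (\<rho> e\<^sub>l + c K e\<^sub>l)\<close> (lemma \<open>error_step\<close>). So only two bilinear forms matter: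
  \<open>d(u, v) = (\<rho> u, v)\<close> and \<open>k(u, v) = c (K u, v)\<close>. The squares of the two norms in the claim are \<open>d\<close> and
  \<open>d + k\<close>.

  The forms satisfy \<open>0 \<le> k \<le> \<kappa> d\<close> with \<open>\<kappa> = (1 - \<epsilon>\<^sub>0\<^sup>2) / 2\<close>. Commutativity makes \<open>K\<close> self-adjoint, and an
  eigenvalue \<open>m\<close> of \<open>K\<close> satisfies \<open>A u = m B u\<close> for some \<open>u \<noteq> 0\<close>. Pairing this with \<open>u\<close> and using
  \<open>0 < A \<le> \<alpha>\<^sup>2 B\<close> gives \<open>0 < m \<le> \<alpha>\<^sup>2\<close>. The extreme values of the Rayleigh quotient of \<open>K\<close> are
  eigenvalues, so \<open>0 \<le> K \<le> \<alpha>\<^sup>2\<close>; the condition on \<open>h\<^sub>t\<close> and \<open>\<rho> \<ge> \<rho>_low\<close> then give the bound by \<open>\<kappa> d\<close>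
  (lemmas \<open>symmetric_form_nonneg_if_eigenvalues_nonneg\<close> and \<open>inv_into_comp_form_bounds\<close>). This avoids both
  the square root of \<open>B\<close> and a common eigenbasis of \<open>A\<close> and \<open>B\<close>.

  If \<open>P\<close> represents \<open>k\<close> with respect to \<open>d\<close>, then \<open>0 \<le> P \<le> \<kappa>\<close> and one step is \<open>I - \<theta> (I + P) = q - \<theta> P\<close>. Its
  spectrum lies between \<open>q\<close> and \<open>q - \<theta> \<kappa> = - q\<close>: the parameter \<open>\<theta>\<close> is optimal because it centres this
  interval. The lemma \<open>optimal_step_contracts\<close> derives the contraction by \<open>q\<close> in both norms from the
  Cauchy-Schwarz inequality for \<open>k\<close>.
\<close>

section \<open>Symmetric bilinear forms on a subspace\<close>

locale symmetric_form =
  fixes H :: "'a::real_vector set" and f :: "'a \<Rightarrow> 'a \<Rightarrow> real"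
  assumes subspace: "subspace H"
    and add_left: "\<lbrakk>u \<in> H; v \<in> H; x \<in> H\<rbrakk> \<Longrightarrow> f (u + v) x = f u x + f v x"
    and scale_left: "\<lbrakk>u \<in> H; x \<in> H\<rbrakk> \<Longrightarrow> f (c *\<^sub>R u) x = c * f u x"
    and sym: "\<lbrakk>u \<in> H; v \<in> H\<rbrakk> \<Longrightarrow> f u v = f v u"
begin

lemma add_right: "\<lbrakk>u \<in> H; v \<in> H; x \<in> H\<rbrakk> \<Longrightarrow> f x (u + v) = f x u + f x v"
  using add_left sym subspace by (metis subspace_add)

lemma scale_right: "\<lbrakk>u \<in> H; x \<in> H\<rbrakk> \<Longrightarrow> f x (c *\<^sub>R u) = c * f x u"
  using scale_left sym subspace by (metis subspace_scale)

lemma expand_combination: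
  assumes "u \<in> H" "v \<in> H"
  shows "f (a *\<^sub>R u + b *\<^sub>R v) (a *\<^sub>R u + b *\<^sub>R v)
           = a\<^sup>2 * f u u + 2 * a * b * f u v + b\<^sup>2 * f v v"
proof -
  have m: "a *\<^sub>R u \<in> H" "b *\<^sub>R v \<in> H"
    using assms subspace by (auto simp: subspace_scale)
  then have "a *\<^sub>R u + b *\<^sub>R v \<in> H"
    using subspace by (simp add: subspace_add)
  then show ?thesis
    using m assms sym[of v u]
    by (simp add: add_left add_right scale_left scale_right algebra_simps power2_eq_square)
qed

lemma zero: "f 0 0 = 0"
  using scale_left[of 0 0 0] subspace by (simp add: subspace_0)

end

text \<open>
  Null vectors are admitted: a minimiser of a Rayleigh quotient becomes one for the form shifted
  by the minimum, and this is how it is recognised as an eigenvector.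
\<close>

locale semi_inner_form = symmetric_form +
  assumes nonneg: "u \<in> H \<Longrightarrow> 0 \<le> f u u"
begin

lemma Cauchy_Schwarz:
  assumes u: "u \<in> H" and v: "v \<in> H"
  shows "(f u v)\<^sup>2 \<le> f u u * f v v"
proof -
  have quad: "0 \<le> a\<^sup>2 * f u u + 2 * a * b * f u v + b\<^sup>2 * f v v" for a b
    using nonneg[of "a *\<^sub>R u + b *\<^sub>R v"] expand_combination[OF u v, of a b] u v subspace
    by (simp add: subspace_add subspace_scale)
  show ?thesis
  proof (cases "f v v = 0")
    case True
    have "f u v = 0"
    proof (rule ccontr)
      assume nz: "f u v \<noteq> 0"
      \<comment> \<open>Along \<open>v\<close> the form is affine here, so this multiple of \<open>v\<close> makes it equal to \<open>-1\<close>.\<close>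
      show False
        using quad[of 1 "- (f u u + 1) / (2 * f u v)"] True nz by (simp add: field_simps)
    qed
    then show ?thesis using True by simp
  next
    case False
    then have pos: "0 < f v v" using nonneg[OF v] by simp
    have "0 \<le> f v v * (f u u * f v v - (f u v)\<^sup>2)"
      using quad[of "f v v" "- f u v"] by (simp add: algebra_simps power2_eq_square)
    then show ?thesis using pos by (simp add: zero_le_mult_iff)
  qed
qed

end

section \<open>Sign of a form from its eigenvalues\<close>

lemma symmetric_form_minus_scaled:
  assumes "symmetric_form H k" "symmetric_form H g"
  shows "symmetric_form H (\<lambda>u v. k u v - m * g u v)"
proof -
  interpret k: symmetric_form H k by fact
  interpret g: symmetric_form H g by fact
  show ?thesis
    by unfold_locales
      (auto simp: k.subspace k.add_left g.add_left k.scale_left g.scale_left algebra_simps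
        k.sym g.sym)
qed

text \<open>
  Composing with a retraction extends maps that are linear on \<open>H\<close> alone to linear maps on the whole
  space, where continuity and the dimension formula are available.
\<close>

lemma subspace_linear_retraction:
  fixes H :: "'a::euclidean_space set"
  assumes "subspace H"
  obtains r where "linear r" "\<And>x. r x \<in> H" "\<And>x. x \<in> H \<Longrightarrow> r x = x"
proof -
  have "\<exists>r. range r \<subseteq> H \<and> linear r \<and> (\<forall>x\<in>H. r x = x)"
    using linear_exists_left_inverse_on[OF linear_id assms] by simp
  then show ?thesis using that by blast
qed

lemma continuous_on_symmetric_form_diagonal:
  fixes H :: "'a::euclidean_space set"
  assumes "symmetric_form H f"
  shows "continuous_on H (\<lambda>u. f u u)"
proof -
  interpret symmetric_form H f by fact
  obtain r where r: "linear r" "\<And>x. r x \<in> H" "\<And>x. x \<in> H \<Longrightarrow> r x = x"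
    using subspace_linear_retraction[OF subspace] by blast
  have "bilinear (\<lambda>x y. f (r x) (r y))"
    unfolding bilinear_def
    by (auto intro!: linearI simp: linear_add[OF r(1)] linear_scale[OF r(1)] r(2)
        add_left add_right scale_left scale_right)
  then have "bounded_bilinear (\<lambda>x y. f (r x) (r y))"
    by (simp add: bilinear_conv_bounded_bilinear)
  then have "continuous_on H (\<lambda>x. f (r x) (r x))"
    by (rule bounded_bilinear.continuous_on) (auto intro: continuous_intros)
  then show ?thesis
    by (rule continuous_on_eq) (simp add: r(3))
qed

text \<open>
  The minimum \<open>m\<close> of the Rayleigh quotient \<open>k(x, x) / g(x, x)\<close> exists because the unit sphere of \<open>H\<close> is
  compact. By minimality \<open>k - m g\<close> is positive semidefinite with the minimiser as a null vector, hence
  \<open>m\<close> is an eigenvalue and, by hypothesis, \<open>m \<ge> 0\<close>.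
\<close>

lemma symmetric_form_nonneg_if_eigenvalues_nonneg:
  fixes H :: "'a::euclidean_space set"
  assumes k: "symmetric_form H k" and g: "symmetric_form H g"
    and pos: "\<And>u. u \<in> H \<Longrightarrow> u \<noteq> 0 \<Longrightarrow> 0 < g u u"
    and eig: "\<And>u m. \<lbrakk>u \<in> H; u \<noteq> 0; \<And>v. v \<in> H \<Longrightarrow> k u v = m * g u v\<rbrakk> \<Longrightarrow> 0 \<le> m"
    and v: "v \<in> H"
  shows "0 \<le> k v v"
proof (cases "v = 0")
  case True
  then show ?thesis using symmetric_form.zero[OF k] by simp
next
  case False
  interpret k: symmetric_form H k by fact
  interpret g: symmetric_form H g by fact
  let ?S = "H \<inter> sphere 0 1"
  let ?R = "\<lambda>x. k x x / g x x"
  have unit: "(1 / norm x) *\<^sub>R x \<in> ?S" if "x \<in> H" "x \<noteq> 0" for x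
    using that k.subspace by (simp add: subspace_scale)
  have S_pos: "g x x > 0" if "x \<in> ?S" for x
    using that pos[of x] by (cases "x = 0") auto
  have "compact ?S"
    using closed_subspace[OF k.subspace] by (simp add: closed_Int_compact)
  moreover have "?S \<noteq> {}"
    using unit[OF v False] by blast
  moreover have "continuous_on ?S ?R"
    using S_pos
    by (intro continuous_on_divide
        continuous_on_subset[OF continuous_on_symmetric_form_diagonal[OF k]]
        continuous_on_subset[OF continuous_on_symmetric_form_diagonal[OF g]])
      (auto simp: less_le)
  ultimately obtain u where u: "u \<in> ?S" and min: "\<And>x. x \<in> ?S \<Longrightarrow> ?R u \<le> ?R x"
    using continuous_attains_inf[of ?S ?R] by blast
  define m where "m = ?R u"
  have uH: "u \<in> H" "u \<noteq> 0" using u by auto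
  have lower: "m * g x x \<le> k x x" if x: "x \<in> H" for x
  proof (cases "x = 0")
    case True
    then show ?thesis by (simp add: k.zero g.zero)
  next
    case False
    have "?R ((1 / norm x) *\<^sub>R x) = ?R x"
      using x False k.subspace
      by (simp add: k.scale_left k.scale_right g.scale_left g.scale_right subspace_scale)
    then have "m \<le> ?R x" using min[OF unit[OF x False]] by (simp add: m_def)
    then show ?thesis using pos[OF x False] by (simp add: field_simps)
  qed
  interpret diff: symmetric_form H "\<lambda>x y. k x y - m * g x y"
    by (rule symmetric_form_minus_scaled[OF k g])
  interpret diff: semi_inner_form H "\<lambda>x y. k x y - m * g x y"
    by unfold_locales (simp add: lower)
  \<comment> \<open>A null vector of a semidefinite form lies in its kernel, so \<open>u\<close> is an eigenvector.\<close>
  have "k u x = m * g u x" if x: "x \<in> H" for x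
  proof -
    have "k u u - m * g u u = 0" using S_pos[OF u] by (simp add: m_def)
    then have "(k u x - m * g u x)\<^sup>2 \<le> 0" using diff.Cauchy_Schwarz[OF uH(1) x] by simp
    then show ?thesis by simp
  qed
  then have "0 \<le> m" using eig[OF uH] by blast
  then show ?thesis
    using lower[OF v] pos[OF v False] by (meson dual_order.trans less_imp_le mult_nonneg_nonneg)
qed

section \<open>One step of the iteration as a contraction\<close>

text \<open>
  The new error is \<open>e = q u - \<theta> p\<close>, where \<open>d(p, v) = k(u, v)\<close> for all \<open>v \<in> H\<close>. The
  choice of \<open>\<theta>\<close> gives \<open>\<theta>\<^sup>2 \<kappa> = 2 q \<theta>\<close>, so expanding the square yields
  \<open>d(e, e) = q\<^sup>2 d(u, u) - \<theta>\<^sup>2 (\<kappa> k(u, u) - d(p, p))\<close> and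
  \<open>k(e, e) = q\<^sup>2 k(u, u) - \<theta>\<^sup>2 (\<kappa> d(p, p) - k(p, p))\<close>. The second bracket is nonnegative by the
  bound on \<open>k\<close>; the first one is too, by that bound and the Cauchy-Schwarz inequality for
  \<open>d(p, p) = k(u, p)\<close>.
\<close>

lemma optimal_step_contracts:
  assumes d: "semi_inner_form H d" and k: "semi_inner_form H k"
    and bound: "\<And>v. v \<in> H \<Longrightarrow> k v v \<le> \<kappa> * d v v"
    and kap: "0 \<le> \<kappa>" and q: "q = \<kappa> / (2 + \<kappa>)" and th: "\<theta> = 2 / (2 + \<kappa>)"
    and u: "u \<in> H" and e: "e \<in> H"
    and step: "\<And>v. v \<in> H \<Longrightarrow> d (e - u) v = - \<theta> * (d u v + k u v)"
  shows "d e e \<le> q\<^sup>2 * d u u" and "d e e + k e e \<le> q\<^sup>2 * (d u u + k u u)"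
proof -
  interpret d: semi_inner_form H d by fact
  interpret k: semi_inner_form H k by fact
  have th0: "\<theta> > 0" and q_th: "q = 1 - \<theta>" and opt: "\<theta>\<^sup>2 * \<kappa> = 2 * q * \<theta>"
    and q0: "0 \<le> q"
    using kap by (auto simp: q th field_simps power2_eq_square)
  \<comment> \<open>Solving for \<open>p\<close> places it in \<open>H\<close>; that it represents \<open>k u\<close> with respect to \<open>d\<close> then follows
    from the step equation.\<close>
  define p where "p = (1 / \<theta>) *\<^sub>R (q *\<^sub>R u - e)"
  have p: "p \<in> H"
    unfolding p_def using u e d.subspace by (simp add: subspace_diff subspace_scale)
  have e_eq: "e = q *\<^sub>R u + (- \<theta>) *\<^sub>R p"
    using th0 by (simp add: p_def)
  have represents: "d p v = k u v" if v: "v \<in> H" for v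
  proof -
    have "e - u = (- \<theta>) *\<^sub>R u + (- \<theta>) *\<^sub>R p"
      by (simp add: e_eq q_th algebra_simps)
    then have "d (e - u) v = - \<theta> * d u v + - \<theta> * d p v"
      using u p v d.subspace by (simp add: d.add_left d.scale_left subspace_scale subspace_neg
          del: scaleR_minus_left)
    then have "\<theta> * d p v = \<theta> * k u v" using step[OF v] by (auto simp: distrib_left)
    then show ?thesis using th0 by simp
  qed
  have dpu: "d u p = k u u" using represents[OF u] d.sym[OF u p] by simp
  have dpp: "d p p = k u p" using represents[OF p] .
  have kpp: "k p p \<le> \<kappa> * d p p" by (rule bound[OF p])
  have key: "d p p \<le> \<kappa> * k u u"
  proof (cases "d p p = 0")
    case True
    then show ?thesis using kap k.nonneg[OF u] by simp
  next
    case False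
    then have pos: "0 < d p p" using d.nonneg[OF p] by simp
    have "(d p p)\<^sup>2 \<le> k u u * k p p" using k.Cauchy_Schwarz[OF u p] dpp by simp
    also have "\<dots> \<le> k u u * (\<kappa> * d p p)" using kpp k.nonneg[OF u] by (rule mult_left_mono)
    finally have "d p p * d p p \<le> (\<kappa> * k u u) * d p p" by (simp add: power2_eq_square mult_ac)
    then show ?thesis using pos by simp
  qed
  have de: "d e e = q\<^sup>2 * d u u - 2 * q * \<theta> * k u u + \<theta>\<^sup>2 * d p p"
    unfolding e_eq using d.expand_combination[OF u p, of q "- \<theta>"] dpu by simp
  have ke: "k e e = q\<^sup>2 * k u u - 2 * q * \<theta> * d p p + \<theta>\<^sup>2 * k p p"
    unfolding e_eq using k.expand_combination[OF u p, of q "- \<theta>"] dpp by simp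
  have "\<theta>\<^sup>2 * d p p \<le> \<theta>\<^sup>2 * (\<kappa> * k u u)" using key by (rule mult_left_mono) simp
  also have "\<dots> = 2 * q * \<theta> * k u u" by (simp add: opt flip: mult.assoc)
  finally show 1: "d e e \<le> q\<^sup>2 * d u u" using de by simp
  have "\<theta>\<^sup>2 * k p p \<le> \<theta>\<^sup>2 * (\<kappa> * d p p)" using kpp by (rule mult_left_mono) simp
  also have "\<dots> = 2 * q * \<theta> * d p p" by (simp add: opt flip: mult.assoc)
  finally have "k e e \<le> q\<^sup>2 * k u u" using ke by simp
  with 1 show "d e e + k e e \<le> q\<^sup>2 * (d u u + k u u)" by (simp add: algebra_simps)
qed

lemma sqrt_geometric_decay:
  fixes a :: "nat \<Rightarrow> real"
  assumes "\<And>l. a (Suc l) \<le> q\<^sup>2 * a l" and q: "0 \<le> q"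
  shows "sqrt (a l) \<le> q ^ l * sqrt (a 0)"
proof (induction l)
  case (Suc l)
  have "sqrt (a (Suc l)) \<le> sqrt (q\<^sup>2 * a l)" using assms(1) by simp
  also have "\<dots> = q * sqrt (a l)" using q by (simp add: real_sqrt_mult)
  also have "\<dots> \<le> q * (q ^ l * sqrt (a 0))" using Suc q by (rule mult_left_mono)
  finally show ?case by simp
qed simp

section \<open>The mesh inner product and \<open>B\<^sup>-\<^sup>1 A\<close>\<close>

lemma mesh_inner_commute: "mesh_inner \<mu> u v = mesh_inner \<mu> v u"
  by (simp add: mesh_inner_def mult_ac)

lemma mesh_inner_add_left: "mesh_inner \<mu> (u + v) x = mesh_inner \<mu> u x + mesh_inner \<mu> v x"
  by (simp add: mesh_inner_def algebra_simps sum.distrib)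

lemma mesh_inner_scale_left: "mesh_inner \<mu> (c *\<^sub>R u) x = c * mesh_inner \<mu> u x"
  by (simp add: mesh_inner_def sum_distrib_left mult_ac)

lemma symmetric_form_operator:
  assumes "subspace H" "linear_op_in H C"
    and "\<And>u v. \<lbrakk>u \<in> H; v \<in> H\<rbrakk> \<Longrightarrow> mesh_inner \<mu> (C u) v = mesh_inner \<mu> u (C v)"
  shows "symmetric_form H (\<lambda>u v. mesh_inner \<mu> (C u) v)"
proof unfold_locales
  fix u v
  assume "u \<in> H" "v \<in> H"
  then show "mesh_inner \<mu> (C u) v = mesh_inner \<mu> (C v) u"
    by (simp only: assms(3) mesh_inner_commute[of \<mu> "C v" u])
qed (use assms(1,2) in \<open>auto simp: linear_op_in_def mesh_inner_add_left mesh_inner_scale_left\<close>)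

lemma selfadjoint_pos_bij_betw:
  fixes H :: "(real ^ 'n) set"
  assumes H: "subspace H" and B: "selfadjoint_pos \<mu> H B"
  shows "bij_betw B H H"
proof -
  have lin: "linear_op_in H B" and pos: "\<And>u. u \<in> H \<Longrightarrow> u \<noteq> 0 \<Longrightarrow> 0 < mesh_inner \<mu> (B u) u"
    using B by (auto simp: selfadjoint_pos_def)
  obtain r where r: "linear r" "\<And>x. r x \<in> H" "\<And>x. x \<in> H \<Longrightarrow> r x = x"
    using subspace_linear_retraction[OF H] by blast
  have lin': "linear (\<lambda>x. B (r x))"
    using lin by (intro linearI)
      (auto simp: linear_op_in_def linear_add[OF r(1)] linear_scale[OF r(1)] r(2))
  have "x = 0" if "x \<in> H" "B x = 0" for x
    using pos[of x] that by (auto simp: mesh_inner_def)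
  then have inj': "inj_on (\<lambda>x. B (r x)) H"
    using linear_injective_on_subspace_0[OF lin' H] r(3) by simp
  have img: "(\<lambda>x. B (r x)) ` H = B ` H" using r(3) by (auto simp: image_iff)
  have sub: "subspace (B ` H)" using linear_subspace_image[OF lin' H] img by simp
  have "dim ((\<lambda>x. B (r x)) ` H) = dim H"
    using dim_image_eq[OF lin'] inj' H by (metis span_eq_iff)
  then have "B ` H = H"
    using subspace_dim_equal[OF sub H] lin img by (auto simp: linear_op_in_def)
  moreover have "inj_on B H" using inj' r(3) by (auto simp: inj_on_def)
  ultimately show ?thesis by (simp add: bij_betw_def)
qed

lemma linear_op_in_inv_into_comp:
  assumes H: "subspace H" and A: "linear_op_in H A" and B: "linear_op_in H B"
    and bij: "bij_betw B H H"
  shows "linear_op_in H (\<lambda>u. inv_into H B (A u))"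
proof -
  have inv: "inv_into H B x \<in> H" "B (inv_into H B x) = x" if "x \<in> H" for x
    using bij_betw_imp_surj_on[OF bij] that inv_into_into f_inv_into_f by metis+
  have eq: "inv_into H B y = x" if "x \<in> H" "B x = y" for x y
    using bij that by (metis bij_betw_imp_inj_on inv_into_f_f)
  show ?thesis
    using A B H inv
    by (auto simp: linear_op_in_def intro!: eq simp: subspace_add subspace_scale)
qed

text \<open>
  Writing \<open>u = B x\<close> and \<open>v = B y\<close> turns \<open>B\<^sup>-\<^sup>1 A u\<close> into \<open>A x\<close> by commutativity, so that the inverse
  disappears from both sides.
\<close>

lemma inv_into_comp_selfadjoint:
  assumes A: "selfadjoint_pos \<mu> H A" and B: "selfadjoint_pos \<mu> H B"
    and comm: "\<And>u. u \<in> H \<Longrightarrow> A (B u) = B (A u)" and bij: "bij_betw B H H"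
    and u: "u \<in> H" and v: "v \<in> H"
  shows "mesh_inner \<mu> (inv_into H B (A u)) v = mesh_inner \<mu> u (inv_into H B (A v))"
proof -
  have sa: "\<And>x y. \<lbrakk>x \<in> H; y \<in> H\<rbrakk> \<Longrightarrow> mesh_inner \<mu> (A x) y = mesh_inner \<mu> x (A y)"
    "\<And>x y. \<lbrakk>x \<in> H; y \<in> H\<rbrakk> \<Longrightarrow> mesh_inner \<mu> (B x) y = mesh_inner \<mu> x (B y)"
    and AH: "\<And>x. x \<in> H \<Longrightarrow> A x \<in> H" and BH: "\<And>x. x \<in> H \<Longrightarrow> B x \<in> H"
    using A B by (auto simp: selfadjoint_pos_def linear_op_in_def)
  obtain x y where x: "x \<in> H" "u = B x" and y: "y \<in> H" "v = B y"
    using bij u v by (metis bij_betw_imp_surj_on imageE)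
  have K: "inv_into H B (A (B z)) = A z" if "z \<in> H" for z
    using that AH comm bij by (simp add: bij_betw_imp_inj_on)
  have "mesh_inner \<mu> (A x) (B y) = mesh_inner \<mu> x (A (B y))"
    using sa(1) x y BH by simp
  also have "\<dots> = mesh_inner \<mu> (B x) (A y)"
    using sa(2) comm x y AH by simp
  finally show ?thesis using x y K by simp
qed

text \<open>
  An eigenvector of \<open>B\<^sup>-\<^sup>1 A\<close> with eigenvalue \<open>m\<close> satisfies \<open>A u = m B u\<close>, so positivity of \<open>A\<close> and \<open>B\<close> and
  \<open>A \<le> \<beta> B\<close>, all of them tested with the same \<open>u\<close>, place \<open>m\<close> in \<open>[0, \<beta>]\<close>. The two
  bounds are the nonnegativity of \<open>k\<close> and of \<open>\<beta> (\<cdot>, \<cdot>) - k\<close>, whose eigenvalues are \<open>m\<close> and \<open>\<beta> - m\<close>.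
\<close>

lemma inv_into_comp_form_bounds:
  fixes H :: "(real ^ 'n) set"
  assumes mesh: "mesh_space \<mu> H" and A: "selfadjoint_pos \<mu> H A" and B: "selfadjoint_pos \<mu> H B"
    and comm: "\<And>u. u \<in> H \<Longrightarrow> A (B u) = B (A u)"
    and le: "op_le \<mu> H A (\<lambda>u. \<beta> *\<^sub>R B u)"
  defines "k \<equiv> \<lambda>u v. mesh_inner \<mu> (inv_into H B (A u)) v"
  shows "semi_inner_form H k" and "\<And>v. v \<in> H \<Longrightarrow> k v v \<le> \<beta> * mesh_inner \<mu> v v"
proof -
  have H: "subspace H" and pos: "\<And>u. u \<in> H \<Longrightarrow> u \<noteq> 0 \<Longrightarrow> 0 < mesh_inner \<mu> u u"
    using mesh by (auto simp: mesh_space_def)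
  have linA: "linear_op_in H A" and linB: "linear_op_in H B"
    and posA: "\<And>u. u \<in> H \<Longrightarrow> u \<noteq> 0 \<Longrightarrow> 0 < mesh_inner \<mu> (A u) u"
    and posB: "\<And>u. u \<in> H \<Longrightarrow> u \<noteq> 0 \<Longrightarrow> 0 < mesh_inner \<mu> (B u) u"
    using A B by (auto simp: selfadjoint_pos_def)
  note bij = selfadjoint_pos_bij_betw[OF H B]
  define K where "K = (\<lambda>u. inv_into H B (A u))"
  have linK: "linear_op_in H K"
    unfolding K_def by (rule linear_op_in_inv_into_comp[OF H linA linB bij])
  have KH: "K u \<in> H" if "u \<in> H" for u
    using linK that by (simp add: linear_op_in_def)
  have BK: "B (K u) = A u" if "u \<in> H" for u
    using linA bij_betw_imp_surj_on[OF bij] that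
    by (auto simp: K_def linear_op_in_def intro!: f_inv_into_f)
  have k_def': "k = (\<lambda>u v. mesh_inner \<mu> (K u) v)"
    by (simp add: k_def K_def)
  have k: "symmetric_form H k"
    unfolding k_def' using linK
    by (rule symmetric_form_operator[OF H])
      (unfold K_def, rule inv_into_comp_selfadjoint[OF A B comm bij])
  have g: "symmetric_form H (mesh_inner \<mu>)"
    using symmetric_form_operator[OF H, of "\<lambda>u. u" \<mu>] by (simp add: linear_op_in_def)
  have eigen: "0 \<le> m \<and> m \<le> \<beta>"
    if u: "u \<in> H" "u \<noteq> 0" and m: "\<And>v. v \<in> H \<Longrightarrow> k u v = m * mesh_inner \<mu> u v" for u m
  proof -
    have diff: "K u + (- m) *\<^sub>R u \<in> H"
      using KH[OF u(1)] u(1) H by (intro subspace_add subspace_scale)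
    have "mesh_inner \<mu> (K u + (- m) *\<^sub>R u) v = 0" if "v \<in> H" for v
      using m[OF that] unfolding k_def' mesh_inner_add_left mesh_inner_scale_left by simp
    then have "K u + (- m) *\<^sub>R u = 0"
      using pos[OF diff] diff by force
    then have "K u = m *\<^sub>R u" by simp
    then have "A u = m *\<^sub>R B u"
      using BK[OF u(1)] linB u(1) by (simp add: linear_op_in_def)
    then have "mesh_inner \<mu> (A u) u = m * mesh_inner \<mu> (B u) u"
      by (simp add: mesh_inner_scale_left)
    moreover have "mesh_inner \<mu> (A u) u \<le> \<beta> * mesh_inner \<mu> (B u) u"
      using le u by (simp add: op_le_def mesh_inner_scale_left)
    ultimately show ?thesis
      using posA[OF u] posB[OF u] by (simp add: zero_less_mult_iff)
  qed
  have "0 \<le> k v v" if "v \<in> H" for v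
    using symmetric_form_nonneg_if_eigenvalues_nonneg[OF k g pos conjunct1[OF eigen] that] .
  then show "semi_inner_form H k"
    using k by (simp add: semi_inner_form_def semi_inner_form_axioms_def)
  have k': "symmetric_form H (\<lambda>u v. \<beta> * mesh_inner \<mu> u v - k u v)"
  proof -
    interpret k: symmetric_form H k by (rule k)
    interpret g: symmetric_form H "mesh_inner \<mu>" by (rule g)
    show ?thesis
      by unfold_locales
        (simp_all add: H k.add_left g.add_left k.scale_left g.scale_left right_diff_distrib
          distrib_left mult.left_commute, simp only: k.sym g.sym)
  qed
  have upper: "0 \<le> \<beta> * mesh_inner \<mu> v v - k v v" if "v \<in> H" for v
  proof (rule symmetric_form_nonneg_if_eigenvalues_nonneg[OF k' g pos _ that])
    fix u m
    assume u: "u \<in> H" "u \<noteq> 0"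
      and m: "\<And>v. v \<in> H \<Longrightarrow> \<beta> * mesh_inner \<mu> u v - k u v = m * mesh_inner \<mu> u v"
    have "k u v = (\<beta> - m) * mesh_inner \<mu> u v" if "v \<in> H" for v
      using m[OF that] unfolding left_diff_distrib by linarith
    then have "\<beta> - m \<le> \<beta>"
      using eigen[OF u] by blast
    then show "0 \<le> m" by simp
  qed
  show "k v v \<le> \<beta> * mesh_inner \<mu> v v" if "v \<in> H" for v
    using upper[OF that] by simp
qed

lemma mesh_norm_sqrt_weight:
  assumes "\<And>i. 0 \<le> \<rho> $ i"
  shows "mesh_norm \<mu> ((\<chi> i. sqrt (\<rho> $ i)) * u) = sqrt (mesh_inner \<mu> (\<rho> * u) u)"
proof -
  have "\<mu> $ i * (sqrt (\<rho> $ i) * u $ i) * (sqrt (\<rho> $ i) * u $ i) = \<mu> $ i * (\<rho> $ i * u $ i) * u $ i"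
    (is "?l = ?r") for i
  proof -
    have "?l = (sqrt (\<rho> $ i))\<^sup>2 * (\<mu> $ i * (u $ i)\<^sup>2)"
      by (simp only: power2_eq_square mult_ac)
    also have "\<dots> = \<rho> $ i * (\<mu> $ i * (u $ i)\<^sup>2)"
      by (simp only: real_sqrt_pow2[OF assms])
    also have "\<dots> = ?r" by (simp only: power2_eq_square mult_ac)
    finally show ?thesis .
  qed
  then show ?thesis
    by (simp only: mesh_norm_def mesh_inner_def vector_mult_component vec_lambda_beta)
qed

lemma weighted_mesh_form:
  fixes H :: "(real ^ 'n) set" and c :: real
  assumes mesh: "mesh_space \<mu> H" and low: "\<And>i. c \<le> \<rho> $ i" and c: "0 \<le> c"
  shows "c * mesh_inner \<mu> u u \<le> mesh_inner \<mu> (\<rho> * u) u"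
    and "semi_inner_form H (\<lambda>u v. mesh_inner \<mu> (\<rho> * u) v)"
proof -
  have mu: "0 \<le> \<mu> $ i" for i using mesh by (simp add: mesh_space_def)
  have le: "c * mesh_inner \<mu> u u \<le> mesh_inner \<mu> (\<rho> * u) u" for u
    unfolding mesh_inner_def sum_distrib_left
  proof (rule sum_mono)
    fix i
    have "c * (\<mu> $ i * (u $ i)\<^sup>2) \<le> \<rho> $ i * (\<mu> $ i * (u $ i)\<^sup>2)"
      using low[of i] mu[of i] by (intro mult_right_mono) auto
    then show "c * (\<mu> $ i * u $ i * u $ i) \<le> \<mu> $ i * (\<rho> * u) $ i * u $ i"
      by (simp add: power2_eq_square mult_ac)
  qed
  then show "c * mesh_inner \<mu> u u \<le> mesh_inner \<mu> (\<rho> * u) u" .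
  have "0 \<le> mesh_inner \<mu> u u" for u
    unfolding mesh_inner_def by (intro sum_nonneg) (simp add: mu mult.assoc)
  then have nonneg: "0 \<le> mesh_inner \<mu> (\<rho> * u) u" for u
    using le[of u] c by (meson mult_nonneg_nonneg order_trans)
  show "semi_inner_form H (\<lambda>u v. mesh_inner \<mu> (\<rho> * u) v)"
    using mesh
    by unfold_locales
      (simp_all add: mesh_space_def distrib_left mesh_inner_add_left mesh_inner_scale_left nonneg,
        simp only: mesh_inner_def vector_mult_component mult_ac)
qed

text \<open>
  The next error is described through its \<open>\<rho>\<close>-multiple rather than by dividing by \<open>\<rho>\<close>: this is the
  form in which the step enters the weighted inner product.
\<close>

lemma error_step:
  assumes H: "subspace H" and B: "linear_op_in H B" and bij: "bij_betw B H H"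
    and A: "linear_op_in H A"
    and \<rho>H: "\<And>u. u \<in> H \<Longrightarrow> \<rho> * u \<in> H"
    and mem: "w \<in> H" "x \<in> H" "y \<in> H" and th: "\<theta> \<noteq> 0"
    and sol: "B (\<rho> * w) + c *\<^sub>R A w = b"
    and it: "B (\<rho> * ((y - x) /\<^sub>R \<theta>)) + B (\<rho> * x) + c *\<^sub>R A x = b"
  shows "\<rho> * ((w - y) - (w - x)) = (- \<theta>) *\<^sub>R (\<rho> * (w - x) + c *\<^sub>R inv_into H B (A (w - x)))"
proof -
  let ?K = "\<lambda>u. inv_into H B (A u)"
  have KH: "?K u \<in> H" if "u \<in> H" for u
    using linear_op_in_inv_into_comp[OF H A B bij] that by (simp add: linear_op_in_def)
  have BK: "B (?K u) = A u" if "u \<in> H" for u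
    using A bij_betw_imp_surj_on[OF bij] that
    by (auto simp: linear_op_in_def intro!: f_inv_into_f)
  have Badd: "B (u + v) = B u + B v" if "u \<in> H" "v \<in> H" for u v
    using B that by (simp add: linear_op_in_def)
  have Bsc: "B (a *\<^sub>R u) = a *\<^sub>R B u" if "u \<in> H" for u a
    using B that by (simp add: linear_op_in_def)
  let ?z = "\<rho> * ((y - x) /\<^sub>R \<theta>)"
  have z: "?z \<in> H" using \<rho>H mem H by (simp add: subspace_diff subspace_scale)
  have l: "?z + \<rho> * x + c *\<^sub>R ?K x \<in> H" and r: "\<rho> * w + c *\<^sub>R ?K w \<in> H"
    using z \<rho>H[OF mem(1)] \<rho>H[OF mem(2)] KH[OF mem(1)] KH[OF mem(2)] H
    by (simp_all add: subspace_add subspace_scale)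
  have "B (?z + \<rho> * x + c *\<^sub>R ?K x) = B (\<rho> * w + c *\<^sub>R ?K w)"
    using sol it z \<rho>H[OF mem(1)] \<rho>H[OF mem(2)] KH[OF mem(1)] KH[OF mem(2)] H
    by (simp add: Badd Bsc BK mem subspace_add subspace_scale)
  then have eq: "?z + \<rho> * x + c *\<^sub>R ?K x = \<rho> * w + c *\<^sub>R ?K w"
    by (rule inj_onD[OF bij_betw_imp_inj_on[OF bij] _ l r])
  have "?K ((w - x) + x) = ?K (w - x) + ?K x"
    using linear_op_in_inv_into_comp[OF H A B bij] mem(2) subspace_diff[OF H mem(1,2)]
    unfolding linear_op_in_def by blast
  then have Kdiff: "?K (w - x) = ?K w - ?K x" by simp
  have residual: "\<rho> * (w - x) + c *\<^sub>R ?K (w - x) = ?z"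
    using eq by (simp add: Kdiff algebra_simps)
  have "\<rho> * ((w - y) - (w - x)) = - (\<rho> * (y - x))"
    by (simp add: algebra_simps)
  also have "\<rho> * (y - x) = \<theta> *\<^sub>R ?z"
    using th by (simp add: vec_eq_iff)
  finally show ?thesis by (simp only: residual scaleR_minus_left)
qed

section \<open>Convergence rate\<close>

theorem theorem1:
  fixes \<mu> \<rho> b w :: "real ^ 'n"
    and H :: "(real ^ 'n) set"
    and A B :: "real ^ 'n \<Rightarrow> real ^ 'n"
    and \<alpha> h\<^sub>t \<rho>_low \<epsilon>\<^sub>0 :: real
    and wit :: "nat \<Rightarrow> real ^ 'n"
  assumes "mesh_space \<mu> H"
    and "selfadjoint_pos \<mu> H A"
    and "selfadjoint_pos \<mu> H B"
    and "\<forall>u\<in>H. A (B u) = B (A u)"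
    and "0 < \<rho>_low"
    and "\<forall>i. \<rho>_low \<le> \<rho> $ i"
    and "\<forall>u\<in>H. \<rho> * u \<in> H"
    and "0 < h\<^sub>t"
    and "op_le \<mu> H A (\<lambda>u. \<alpha>\<^sup>2 *\<^sub>R B u)"
    and "0 < \<epsilon>\<^sub>0" and "\<epsilon>\<^sub>0 < 1"
    and "1 / 6 * h\<^sub>t\<^sup>2 * \<alpha>\<^sup>2 \<le> (1 - \<epsilon>\<^sub>0\<^sup>2) * \<rho>_low"
    and "b \<in> H"
    and "w \<in> H"
    and "B (\<rho> * w) + (h\<^sub>t\<^sup>2 / 12) *\<^sub>R A w = b"
    and "\<forall>l. wit l \<in> H"
    and "\<forall>l. B (\<rho> * ((wit (Suc l) - wit l) /\<^sub>R theta_opt (\<epsilon>\<^sub>0\<^sup>2)))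
               + B (\<rho> * wit l) + (h\<^sub>t\<^sup>2 / 12) *\<^sub>R A (wit l) = b"
  shows "(\<forall>l. mesh_norm \<mu> ((\<chi> i. sqrt (\<rho> $ i)) * (w - wit l))
                \<le> q0 (\<epsilon>\<^sub>0\<^sup>2) ^ l * mesh_norm \<mu> ((\<chi> i. sqrt (\<rho> $ i)) * (w - wit 0)))
       \<and> (\<forall>l. energy_norm \<mu> (calA H A B \<rho> h\<^sub>t) (w - wit l)
                \<le> q0 (\<epsilon>\<^sub>0\<^sup>2) ^ l * energy_norm \<mu> (calA H A B \<rho> h\<^sub>t) (w - wit 0))
       \<and> (\<forall>s\<in>{0..<1}. q0 s = (1 - s) / (5 - s) \<and> q0 s \<le> 0.2)"
proof -
  define \<kappa> where "\<kappa> = (1 - \<epsilon>\<^sub>0\<^sup>2) / 2"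
  define q where "q = q0 (\<epsilon>\<^sub>0\<^sup>2)"
  define \<theta> where "\<theta> = theta_opt (\<epsilon>\<^sub>0\<^sup>2)"
  define c where "c = h\<^sub>t\<^sup>2 / 12"
  define K where "K = (\<lambda>u. inv_into H B (A u))"
  define d where "d = (\<lambda>u v. mesh_inner \<mu> (\<rho> * u) v)"
  define k where "k = (\<lambda>u v. c * mesh_inner \<mu> (K u) v)"
  have "\<epsilon>\<^sub>0\<^sup>2 < 1" using assms(10,11) by (simp add: power_less_one_iff abs_square_less_1)
  then have kap: "0 \<le> \<kappa>" by (simp add: \<kappa>_def)
  have q: "q = \<kappa> / (2 + \<kappa>)" and th: "\<theta> = 2 / (2 + \<kappa>)"
    by (simp_all add: q_def \<theta>_def q0_def theta_opt_def lambda_bar_def \<kappa>_def)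
  have q0: "0 \<le> q" and th0: "\<theta> \<noteq> 0" using kap q th by auto
  have c0: "0 \<le> c" by (simp add: c_def)
  have H: "subspace H" using assms(1) by (simp add: mesh_space_def)
  have lin: "linear_op_in H A" "linear_op_in H B"
    using assms(2,3) by (auto simp: selfadjoint_pos_def)
  have bij: "bij_betw B H H" by (rule selfadjoint_pos_bij_betw[OF H assms(3)])
  have \<rho>0: "0 \<le> \<rho> $ i" for i using assms(5,6) by (meson less_imp_le order_trans)
  have d: "semi_inner_form H d"
    unfolding d_def using weighted_mesh_form(2)[OF assms(1), of \<rho>_low \<rho>] assms(5,6) by simp
  have K_form: "semi_inner_form H (\<lambda>u v. mesh_inner \<mu> (K u) v)"
    and K_le: "\<And>v. v \<in> H \<Longrightarrow> mesh_inner \<mu> (K v) v \<le> \<alpha>\<^sup>2 * mesh_inner \<mu> v v"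
    unfolding K_def using inv_into_comp_form_bounds[OF assms(1-3) _ assms(9)] assms(4) by blast+
  interpret K: semi_inner_form H "\<lambda>u v. mesh_inner \<mu> (K u) v" by (rule K_form)
  have k: "semi_inner_form H k"
    unfolding k_def using c0
    by unfold_locales (auto simp: H K.add_left K.scale_left K.nonneg algebra_simps K.sym)
  have bound: "k v v \<le> \<kappa> * d v v" if v: "v \<in> H" for v
  proof -
    have vv: "0 \<le> mesh_inner \<mu> v v"
      using assms(1) v by (cases "v = 0") (auto simp: mesh_space_def mesh_inner_def less_imp_le)
    have "k v v \<le> c * (\<alpha>\<^sup>2 * mesh_inner \<mu> v v)"
      unfolding k_def using K_le[OF v] c0 by (rule mult_left_mono)
    also have "\<dots> = (c * \<alpha>\<^sup>2) * mesh_inner \<mu> v v" by simp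
    also have "\<dots> \<le> (\<kappa> * \<rho>_low) * mesh_inner \<mu> v v"
      using assms(12) vv by (intro mult_right_mono) (auto simp: c_def \<kappa>_def mult.commute)
    also have "\<dots> = \<kappa> * (\<rho>_low * mesh_inner \<mu> v v)" by simp
    also have "\<dots> \<le> \<kappa> * d v v"
      unfolding d_def using weighted_mesh_form(1)[OF assms(1), of \<rho>_low \<rho>] assms(5,6) kap
      by (intro mult_left_mono) auto
    finally show ?thesis .
  qed
  define e where "e = (\<lambda>l. w - wit l)"
  have eH: "e l \<in> H" for l
    unfolding e_def using assms(14,16) H by (simp add: subspace_diff)
  have step: "d (e (Suc l) - e l) v = - \<theta> * (d (e l) v + k (e l) v)" for l v
  proof -
    have "\<rho> * (e (Suc l) - e l) = (- \<theta>) *\<^sub>R (\<rho> * e l + c *\<^sub>R K (e l))"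
      unfolding e_def K_def c_def
      using assms(7,14,15,16,17) th0 unfolding \<theta>_def
      by (intro error_step[OF H lin(2) bij lin(1)]) auto
    then show ?thesis
      by (simp add: d_def k_def mesh_inner_scale_left mesh_inner_add_left
          del: scaleR_minus_left)
  qed
  have contract: "d (e (Suc l)) (e (Suc l)) \<le> q\<^sup>2 * d (e l) (e l)"
    "d (e (Suc l)) (e (Suc l)) + k (e (Suc l)) (e (Suc l))
       \<le> q\<^sup>2 * (d (e l) (e l) + k (e l) (e l))" for l
    by (rule optimal_step_contracts[OF d k bound kap q th eH eH step]; assumption)+
  have "sqrt (d (e l) (e l)) \<le> q ^ l * sqrt (d (e 0) (e 0))" for l
    by (rule sqrt_geometric_decay[where a = "\<lambda>l. d (e l) (e l)"], rule contract(1), rule q0)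
  then have first: "mesh_norm \<mu> ((\<chi> i. sqrt (\<rho> $ i)) * (w - wit l))
      \<le> q ^ l * mesh_norm \<mu> ((\<chi> i. sqrt (\<rho> $ i)) * (w - wit 0))" for l
    by (simp add: mesh_norm_sqrt_weight \<rho>0 d_def e_def)
  have "sqrt (d (e l) (e l) + k (e l) (e l)) \<le> q ^ l * sqrt (d (e 0) (e 0) + k (e 0) (e 0))" for l
    by (rule sqrt_geometric_decay[where a = "\<lambda>l. d (e l) (e l) + k (e l) (e l)"],
        rule contract(2), rule q0)
  moreover have "energy_norm \<mu> (calA H A B \<rho> h\<^sub>t) u = sqrt (d u u + k u u)" for u
    by (simp add: energy_norm_def calA_def d_def k_def K_def c_def mesh_inner_add_left
        mesh_inner_scale_left)
  ultimately have second: "energy_norm \<mu> (calA H A B \<rho> h\<^sub>t) (w - wit l)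
      \<le> q ^ l * energy_norm \<mu> (calA H A B \<rho> h\<^sub>t) (w - wit 0)" for l
    by (simp add: e_def)
  have "q0 s = (1 - s) / (5 - s) \<and> q0 s \<le> 0.2" if "s \<in> {0..<1}" for s :: real
  proof -
    have s: "0 \<le> s" "s < 1" using that by auto
    then have "q0 s = (1 - s) / (5 - s)"
      by (simp add: q0_def lambda_bar_def field_simps)
    moreover have "(1 - s) / (5 - s) \<le> 0.2" using s by (simp add: field_simps)
    ultimately show ?thesis by simp
  qed
  with first second show ?thesis by (simp add: q_def)
qed

end
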